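(* Let $\boldsymbol{\pi}_1,\boldsymbol{\pi}_2$ be two labeled multi-Bernoulli (LMB) multi-object densities on the finite subsets of $\mathbb{X}\times\mathbb{L}$, with parameters $\{(r_i(\ell),p_i(\cdot,\ell)):\ell\in D_i\}$, $r_i(\ell)\in[0,1)$, and each $p_i(\cdot,\ell)$ square integrable on $\mathbb{X}$, $i=1,2$. Put $\tilde r_i=1-r_i$ and $\boldsymbol{f}_i(x,\ell)=r_i(\ell)p_i(x,\ell)/\tilde r_i(\ell)$, so that $\boldsymbol{\pi}_i(\boldsymbol{X})=\Delta(\boldsymbol{X})\big(\prod_{\ell\in\mathbb{L}}\tilde r_i(\ell)\big)\prod_{\boldsymbol{x}\in\boldsymbol{X}}\boldsymbol{f}_i(\boldsymbol{x})$. Let $U>0$ be a constant (the unit of hyper-volume in $\mathbb{X}$). Then the Cauchy-Schwarz divergence $$D_{CS}(\boldsymbol{\pi}_1,\boldsymbol{\pi}_2)=-\ln\frac{\int U^{|\boldsymbol{X}|}\boldsymbol{\pi}_1(\boldsymbol{X})\boldsymbol{\pi}_2(\boldsymbol{X})\,\delta\boldsymbol{X}}{\sqrt{\int U^{|\boldsymbol{X}|}\boldsymbol{\pi}_1(\boldsymbol{X})^2\,\delta\boldsymbol{X}\;\int U^{|\boldsymbol{X}|}\boldsymbol{\pi}_2(\boldsymbol{X})^2\,\delta\boldsymbol{X}}}$$ is given by $$D_{CS}(\boldsymbol{\pi}_1,\boldsymbol{\pi}_2)=-\sum_{\ell\in\mathbb{L}}\ln\frac{1+\langle U\boldsymbol{f}_1\boldsymbol{f}_2\rangle(\ell)}{\sqrt{1+\langle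 U\boldsymbol{f}_1^2\rangle(\ell)}\,\sqrt{1+\langle U\boldsymbol{f}_2^2\rangle(\ell)}}.$$
   Context: $\mathbb{X}$ is a finite-dimensional Euclidean space $\mathbb{R}^d$ ($d\ge 1$) with Lebesgue measure (the attribute space) and $\mathbb{L}$ is a countable discrete set (the label space). For a finite set $\boldsymbol{X}\subset\mathbb{X}\times\mathbb{L}$, $|\boldsymbol{X}|$ is its cardinality, $\mathcal{L}(\boldsymbol{X})=\{\ell:(x,\ell)\in\boldsymbol{X}\}$ is its set of labels, and the distinct label indicator $\Delta(\boldsymbol{X})$ equals $1$ if $|\mathcal{L}(\boldsymbol{X})|=|\boldsymbol{X}|$ and $0$ otherwise. The set integral of a function $F$ on finite subsets of $\mathbb{X}\times\mathbb{L}$ is $$\int F(\boldsymbol{X})\,\delta\boldsymbol{X}=\sum_{n=0}^{\infty}\frac1{n!}\sum_{(\ell_1,\dots,\ell_n)\in\mathbb{L}^n}\int_{\mathbb{X}^n}F(\{(x_1,\ell_1),\dots,(x_n,\ell_n)\})\,dx_1\cdots dx_n,$$ where the $n=0$ term is $F(\emptyset)$. For $\boldsymbol{f}:\mathbb{X}\times\mathbb{L}\to\mathbb{R}$, $\langle\boldsymbol{f}\rangle(\ell)=\int_{\mathbb{X}}\boldsymbol{f}(x,\ell)\,dx$. An LMB with parameters $\{(r(\ell),p(\cdot,\ell)):\ell\in D\}$, where $D\subseteq\mathbb{L}$ is finite, $r(\ell)\in[0,1)$ is the existence probability of $\ell$ and $p(\cdot,\ell)$ is a probability density on $\mathbb{X}$,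 has multi-object density $\boldsymbol{\pi}(\boldsymbol{X})=\Delta(\boldsymbol{X})\big(\prod_{\ell\in\mathbb{L}}(1-r(\ell))\big)\prod_{(x,\ell)\in\boldsymbol{X}}\frac{r(\ell)p(x,\ell)}{1-r(\ell)}$, where $r(\ell)=0$ (and $r(\ell)p(\cdot,\ell)=0$) for $\ell\notin D$. All empty products equal $1$. *)

theory Defs
  imports "HOL-Analysis.Analysis" "HOL-Library.Groups_Big_Fun"
begin

text \<open>The attribute space is a Euclidean space \<open>'a\<close>, the label space a countable type \<open>'l\<close>;
  a labeled multi-object state is a finite set of type \<open>('a \<times> 'l) set\<close>.\<close>

definition labels :: "('a \<times> 'l) set \<Rightarrow> 'l set" where
  "labels X = snd ` X"

definition distinct_label_indicator :: "('a \<times> 'l) set \<Rightarrow> real" where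
  "distinct_label_indicator X = (if card (labels X) = card X then 1 else 0)"

text \<open>Points of the \<open>n\<close>-fold power of a Euclidean space are functions on \<open>{..<n}\<close>.
  A finite product of \<^term>\<open>lebesgue\<close> measures need not be complete, hence the completion.\<close>

definition lebesgue_power :: "nat \<Rightarrow> (nat \<Rightarrow> 'a::euclidean_space) measure" where
  "lebesgue_power n = completion (Pi\<^sub>M {..<n} (\<lambda>_. lebesgue))"

text \<open>For \<open>n = 0\<close> the index set of the inner sum is a singleton and the measure a unit point mass,
  so that this term of the series is \<open>F {}\<close>.\<close>

definition multiobject_integral :: "(('a::euclidean_space \<times> 'l) set \<Rightarrow> real) \<Rightarrow> real" where
  "multiobject_integral F =
     suminf (\<lambda>n. 1 / fact n *
        (\<Sum>\<^sub>\<infinity>l\<in>{..<n} \<rightarrow>\<^sub>E (UNIV :: 'l set).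
           LINT x|lebesgue_power n. F ((\<lambda>i. (x i, l i)) ` {..<n})))"

definition attribute_integral :: "('a::euclidean_space \<times> 'l \<Rightarrow> real) \<Rightarrow> 'l \<Rightarrow> real" where
  "attribute_integral f l = (LINT x|lebesgue. f (x, l))"

definition probability_density :: "('a::euclidean_space \<Rightarrow> real) \<Rightarrow> bool" where
  "probability_density p \<longleftrightarrow>
     (\<forall>x. 0 \<le> p x) \<and> integrable lebesgue p \<and> (LINT x|lebesgue. p x) = 1"

text \<open>Outside \<open>D\<close> the existence probability is extended by \<open>0\<close>, while \<open>p\<close> is arbitrary there.\<close>

definition lmb_parameters ::
  "'l set \<Rightarrow> ('l \<Rightarrow> real) \<Rightarrow> ('a::euclidean_space \<times> 'l \<Rightarrow> real) \<Rightarrow> bool" where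
  "lmb_parameters D r p \<longleftrightarrow>
     finite D \<and>
     (\<forall>l\<in>D. 0 \<le> r l \<and> r l < 1 \<and> probability_density (\<lambda>x. p (x, l))) \<and>
     (\<forall>l. l \<notin> D \<longrightarrow> r l = 0)"

text \<open>The product over all labels is \<^const>\<open>Prod_any\<close>, the product of the factors different
  from \<open>1\<close>; \<^const>\<open>prod\<close> over an infinite \<^term>\<open>UNIV\<close> would be \<open>1\<close>.\<close>

definition lmb_density ::
  "('l \<Rightarrow> real) \<Rightarrow> ('a::euclidean_space \<times> 'l \<Rightarrow> real) \<Rightarrow> ('a \<times> 'l) set \<Rightarrow> real" where
  "lmb_density r p X =
     distinct_label_indicator X * Prod_any (\<lambda>l. 1 - r l) *
     (\<Prod>(x, l)\<in>X. r l * p (x, l) / (1 - r l))"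

definition cauchy_schwarz_divergence ::
  "real \<Rightarrow> (('a::euclidean_space \<times> 'l) set \<Rightarrow> real) \<Rightarrow> (('a \<times> 'l) set \<Rightarrow> real) \<Rightarrow> real" where
  "cauchy_schwarz_divergence U \<pi>\<^sub>1 \<pi>\<^sub>2 =
     - ln (multiobject_integral (\<lambda>X. U ^ card X * \<pi>\<^sub>1 X * \<pi>\<^sub>2 X) /
           sqrt (multiobject_integral (\<lambda>X. U ^ card X * (\<pi>\<^sub>1 X)\<^sup>2) *
                 multiobject_integral (\<lambda>X. U ^ card X * (\<pi>\<^sub>2 X)\<^sup>2)))"

end

(*
  Off the null set where two coordinates x_i coincide, the distinct label indicator vanishes unless
  the labels are pairwise distinct, so by Fubini the n-th term of the set integral of
  \<Delta>(X) \<Prod>_{z \<in> X} g(z) is 1/n! times a sum over injective label tuples. This is the n-th elementary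
  symmetric polynomial of the numbers \<langle>g\<rangle>(l), hence the series sums to \<Prod>_l (1 + \<langle>g\<rangle>(l)).
  All three integrals in the divergence have this shape, and the constants \<Prod>_l (1 - r_i(l)) cancel.
*)
theory Submission
  imports Defs
begin

section \<open>Counting injective label tuples by their range\<close>

lemma sum_inj_on_PiE_prod:
  fixes G :: "'l \<Rightarrow> 'b::{comm_semiring_1, semiring_char_0}"
  assumes "finite I" "finite D"
  shows "(\<Sum>f | f \<in> I \<rightarrow>\<^sub>E D \<and> inj_on f I. \<Prod>i\<in>I. G (f i)) =
    fact (card I) * (\<Sum>A | A \<subseteq> D \<and> card A = card I. prod G A)"
proof -
  let ?S = "{f. f \<in> I \<rightarrow>\<^sub>E D \<and> inj_on f I}" and ?T = "{A. A \<subseteq> D \<and> card A = card I}"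
  have fin: "finite ?S" "finite ?T"
    using assms by (auto intro: finite_subset[OF _ finite_PiE[OF assms(1)]] finite_subset[of _ "Pow D"])
  \<comment> \<open>Injections are grouped by their range \<open>A\<close>; the product depends on
    \<open>A\<close> only, and every \<open>A\<close> of size \<open>card I\<close> is hit by
    \<open>card I\<close> factorial injections.\<close>
  have "(\<Sum>f\<in>?S. \<Prod>i\<in>I. G (f i)) = (\<Sum>A\<in>?T. \<Sum>f | f \<in> ?S \<and> f ` I = A. \<Prod>i\<in>I. G (f i))"
    by (rule sum.group[symmetric, OF fin]) (auto simp: card_image)
  also have "\<dots> = (\<Sum>A\<in>?T. fact (card I) * prod G A)"
  proof (rule sum.cong[OF refl])
    fix A assume A: "A \<in> ?T"
    then have fA: "finite A" using assms finite_subset by auto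
    have "{f. f \<in> ?S \<and> f ` I = A} = {f \<in> I \<rightarrow>\<^sub>E A. inj_on f I}" (is "?L = ?R")
    proof (intro equalityI subsetI)
      fix f assume "f \<in> ?R"
      \<comment> \<open>An injection between finite sets of equal size is onto, so prescribing the
        range is the same as prescribing the codomain.\<close>
      moreover from this have "f ` I = A"
        using A fA by (intro card_subset_eq) (auto simp: card_image)
      ultimately show "f \<in> ?L" using A by auto
    qed auto
    moreover have "card {f \<in> I \<rightarrow>\<^sub>E A. inj_on f I} = fact (card I)"
      using A card_inj_on_subset_funcset[OF assms(1) fA order_refl]
      by (simp add: fact_prod_rev)
    moreover have "(\<Prod>i\<in>I. G (f i)) = prod G A" if "f \<in> ?L" for f
      using that prod.reindex[of f I G] by auto
    ultimately show "(\<Sum>f\<in>?L. \<Prod>i\<in>I. G (f i)) = fact (card I) * prod G A"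
      by simp
  qed
  finally show ?thesis by (simp add: sum_distrib_left)
qed

section \<open>Finite powers of Lebesgue measure\<close>

lemma sigma_finite_lebesgue: "sigma_finite_measure (lebesgue :: 'a::euclidean_space measure)"
proof
  obtain A :: "'a set set" where "countable A" "A \<subseteq> sets lborel" "\<Union>A = space lborel"
    "\<forall>a\<in>A. emeasure lborel a \<noteq> \<infinity>"
    using lborel.sigma_finite_countable by blast
  \<comment> \<open>Completion keeps Borel sets measurable and their measure unchanged, so the cover
    for \<open>lborel\<close> serves again.\<close>
  then show "\<exists>A::'a set set. countable A \<and> A \<subseteq> sets lebesgue \<and> \<Union>A = space lebesgue \<and>
      (\<forall>a\<in>A. emeasure lebesgue a \<noteq> \<infinity>)"
    by (intro exI[of _ A]) (auto simp: subset_eq)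
qed

lemma product_sigma_finite_lebesgue:
  "product_sigma_finite (\<lambda>_. lebesgue :: 'a::euclidean_space measure)"
  by (simp add: product_sigma_finite_def sigma_finite_lebesgue)

text \<open>By Tonelli the diagonal is null: when coordinate \<open>i\<close> is integrated first
  with \<open>x j\<close> fixed, its slice is the single point \<open>x j\<close>, which has measure
  zero.\<close>

lemma AE_PiM_lebesgue_components_neq:
  assumes "finite I" "i \<in> I" "j \<in> I" "i \<noteq> j"
  shows "AE x in Pi\<^sub>M I (\<lambda>_. lebesgue :: 'a::euclidean_space measure). x i \<noteq> x j"
proof -
  let ?L = "\<lambda>_. lebesgue :: 'a measure"
  interpret product_sigma_finite ?L
    by (rule product_sigma_finite_lebesgue)
  define J where "J = I - {i}"
  have J: "finite J" "i \<notin> J" "I = insert i J" "j \<in> J" using assms by (auto simp: J_def)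
  let ?f = "\<lambda>x. indicator {y. fst y = (snd y :: 'a)} (x i, x j) :: ennreal"
  \<comment> \<open>Components are read as Borel-valued maps, so that equality of two of them is a
    measurable event.\<close>
  have comp: "(\<lambda>x. x k) \<in> borel_measurable (Pi\<^sub>M I ?L)" if "k \<in> I" for k
    using measurable_compose[OF measurable_component_singleton[OF that, of ?L], of id borel]
    by (simp add: measurable_completion)
  have set: "{x \<in> space (Pi\<^sub>M I ?L). x i = x j} \<in> sets (Pi\<^sub>M I ?L)"
    using comp assms by measurable
  have m: "?f \<in> borel_measurable (Pi\<^sub>M I ?L)"
  proof -
    have "(\<lambda>x. indicator {x \<in> space (Pi\<^sub>M I ?L). x i = x j} x :: ennreal) \<in> borel_measurable (Pi\<^sub>M I ?L)"
      using set by (rule borel_measurable_indicator)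
    then show ?thesis
      by (rule measurable_cong[THEN iffD1, rotated]) (auto simp: indicator_def)
  qed
  have z: "(\<integral>\<^sup>+ y. ?f (x(i := y)) \<partial>?L i) = 0" for x :: "'b \<Rightarrow> 'a"
  proof -
    have "(\<integral>\<^sup>+ y. ?f (x(i := y)) \<partial>?L i) = (\<integral>\<^sup>+ y. indicator {x j} y \<partial>?L i)"
      using assms(4) by (intro nn_integral_cong) (auto simp: indicator_def)
    then show ?thesis by simp
  qed
  have "integral\<^sup>N (Pi\<^sub>M I ?L) ?f = 0"
    using product_nn_integral_insert[OF J(1,2), of ?f] m by (simp add: J(3)[symmetric] z del: fun_upd_apply)
  then have "AE x in Pi\<^sub>M I ?L. ?f x = 0"
    using nn_integral_0_iff_AE[OF m] by simp
  then show ?thesis by eventually_elim (auto simp: indicator_def)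
qed

section \<open>The set integral of a product over distinctly labeled points\<close>

lemma labels_image: "labels ((\<lambda>i. (x i, l i)) ` I) = l ` I"
  by (auto simp: labels_def image_image)

text \<open>If labels repeat, the indicator need not vanish everywhere: where both point and label
  coincide, the set collapses and may again have distinct labels. Off the null set of coinciding
  points there are \<open>n\<close> elements but fewer than \<open>n\<close> labels. If labels are
  injective, the indicator is 1 and Fubini factors the integral.\<close>

lemma integral_distinct_label_prod:
  fixes g :: "'a::euclidean_space \<times> 'l \<Rightarrow> real"
  assumes g: "\<And>l. integrable lebesgue (\<lambda>x. g (x, l))"
  shows "(LINT x|lebesgue_power n. distinct_label_indicator ((\<lambda>i. (x i, l i)) ` {..<n}) * c *
        prod g ((\<lambda>i. (x i, l i)) ` {..<n})) =
      (if inj_on l {..<n} then c * (\<Prod>i<n. attribute_integral g (l i)) else 0)"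
proof (cases "inj_on l {..<n}")
  case True
  interpret product_sigma_finite "\<lambda>_::nat. lebesgue :: 'a measure"
    by (rule product_sigma_finite_lebesgue)
  have inj: "inj_on (\<lambda>i. (x i, l i)) {..<n}" for x :: "nat \<Rightarrow> 'a"
    using True by (auto simp: inj_on_def)
  \<comment> \<open>Integrability supplies measurability for the uncompleted product, under which
    completion does not change the integral.\<close>
  have "integrable (Pi\<^sub>M {..<n} (\<lambda>_. lebesgue)) (\<lambda>x. \<Prod>i<n. g (x i, l i))"
    using product_integrable_prod[of "{..<n}" "\<lambda>i x. g (x, l i)"] g by simp
  then have "(LINT x|lebesgue_power n. (\<Prod>i<n. g (x i, l i))) = (\<Prod>i<n. attribute_integral g (l i))"
    using product_integral_prod[of "{..<n}" "\<lambda>i x. g (x, l i)"] g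
    by (simp add: lebesgue_power_def integral_completion borel_measurable_integrable
        attribute_integral_def)
  moreover have "distinct_label_indicator ((\<lambda>i. (x i, l i)) ` {..<n}) = 1" for x :: "nat \<Rightarrow> 'a"
    by (simp add: distinct_label_indicator_def labels_image card_image[OF True] card_image[OF inj])
  ultimately show ?thesis
    using True by (simp add: prod.reindex[OF inj])
next
  case False
  have "AE x in Pi\<^sub>M {..<n} (\<lambda>_. lebesgue :: 'a measure). \<forall>i\<in>{..<n}. \<forall>j\<in>{..<n}. i \<noteq> j \<longrightarrow> x i \<noteq> x j"
    by (auto simp: AE_finite_all intro!: AE_PiM_lebesgue_components_neq)
  then have "AE x in lebesgue_power n. distinct_label_indicator ((\<lambda>i. (x i, l i)) ` {..<n}) * c *
        prod g ((\<lambda>i. (x i, l i)) ` {..<n}) = 0"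
    \<comment> \<open>A property holds almost everywhere for the completion exactly when it does for
      the original measure.\<close>
    unfolding lebesgue_power_def AE_completion_iff
  proof eventually_elim
    case (elim x)
    then have "inj_on (\<lambda>i. (x i, l i)) {..<n}" by (auto simp: inj_on_def)
    moreover have "card (l ` {..<n}) \<noteq> n"
      using False inj_on_iff_eq_card[of "{..<n}" l] by auto
    ultimately show ?case
      by (simp add: distinct_label_indicator_def labels_image card_image)
  qed
  then show ?thesis using False by (simp add: integral_eq_zero_AE)
qed

text \<open>Because \<open>g\<close> vanishes outside the finite set \<open>D\<close>, both the sum
  over label tuples and the series have finitely many nonzero terms, and no convergence question
  arises.\<close>

lemma multiobject_integral_distinct_label_prod:
  fixes g :: "'a::euclidean_space \<times> 'l \<Rightarrow> real"
  assumes D: "finite D" and g0: "\<And>x l. l \<notin> D \<Longrightarrow> g (x, l) = 0"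
    and int: "\<And>l. l \<in> D \<Longrightarrow> integrable lebesgue (\<lambda>x. g (x, l))"
  shows "multiobject_integral (\<lambda>X. distinct_label_indicator X * c * prod g X) =
    c * (\<Prod>l\<in>D. 1 + attribute_integral g l)"
proof -
  let ?G = "attribute_integral g"
  \<comment> \<open>The \<open>n\<close>-th elementary symmetric polynomial in the numbers
    \<open>attribute_integral g l\<close> with \<open>l\<close> in \<open>D\<close>.\<close>
  define e where "e n = (\<Sum>A | A \<subseteq> D \<and> card A = n. prod ?G A)" for n
  have g: "integrable lebesgue (\<lambda>x. g (x, l))" for l
    using int g0 by (cases "l \<in> D") auto
  have G0: "?G l = 0" if "l \<notin> D" for l
    using that g0 by (simp add: attribute_integral_def)
  have fin: "finite {f. f \<in> {..<n} \<rightarrow>\<^sub>E D \<and> inj_on f {..<n}}" for n :: nat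
    using D by (auto intro: finite_subset[OF _ finite_PiE[of "{..<n}" "\<lambda>_. D"]])
  have "(\<Sum>\<^sub>\<infinity>l\<in>{..<n} \<rightarrow>\<^sub>E UNIV. LINT x|lebesgue_power n.
        distinct_label_indicator ((\<lambda>i. (x i, l i)) ` {..<n}) * c * prod g ((\<lambda>i. (x i, l i)) ` {..<n}))
      = (\<Sum>\<^sub>\<infinity>l\<in>{f. f \<in> {..<n} \<rightarrow>\<^sub>E D \<and> inj_on f {..<n}}. c * (\<Prod>i<n. ?G (l i)))" for n
    unfolding integral_distinct_label_prod[OF g]
  proof (rule infsum_cong_neutral)
    fix l assume l: "l \<in> ({..<n} \<rightarrow>\<^sub>E UNIV) - {f. f \<in> {..<n} \<rightarrow>\<^sub>E D \<and> inj_on f {..<n}}"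
    show "(if inj_on l {..<n} then c * (\<Prod>i<n. ?G (l i)) else 0) = 0"
    proof (cases "inj_on l {..<n}")
      case True
      \<comment> \<open>An injective tuple excluded from the smaller index set must use a label
        outside \<open>D\<close>, which contributes a zero factor.\<close>
      with l obtain i where "i < n" "l i \<notin> D" by (auto simp: PiE_iff)
      then show ?thesis using G0 by (auto intro: prod_zero)
    qed simp
  qed auto
  \<comment> \<open>The factor \<open>fact n\<close> counts the orderings of a label set and cancels
    the weight \<open>1 / fact n\<close> of the set integral.\<close>
  moreover have "(\<Sum>\<^sub>\<infinity>l\<in>{f. f \<in> {..<n} \<rightarrow>\<^sub>E D \<and> inj_on f {..<n}}. c * (\<Prod>i<n. ?G (l i)))
      = fact n * (c * e n)" for n
    using sum_inj_on_PiE_prod[of "{..<n}" D ?G] D fin[of n]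
    by (simp add: e_def sum_distrib_left[symmetric])
  ultimately have "multiobject_integral (\<lambda>X. distinct_label_indicator X * c * prod g X) =
      suminf (\<lambda>n. c * e n)"
    by (simp add: multiobject_integral_def)
  also have "\<dots> = (\<Sum>n\<le>card D. c * e n)"
  proof (rule suminf_finite)
    \<comment> \<open>\<open>D\<close> has no subset with more than \<open>card D\<close>
      elements.\<close>
    fix n assume "n \<notin> {..card D}"
    then have *: "{A. A \<subseteq> D \<and> card A = n} = {}" using card_mono[OF D] by force
    show "c * e n = 0" unfolding e_def * by simp
  qed simp
  also have "\<dots> = c * (\<Sum>A\<in>Pow D. prod ?G A)"
  proof -
    have "card ` Pow D \<subseteq> {..card D}" using card_mono[OF D] by auto
    then show ?thesis
      using sum.group[of "Pow D" "{..card D}" card "prod ?G"] D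
      by (simp add: e_def sum_distrib_left[symmetric])
  qed
  \<comment> \<open>Expanding the product of the sums \<open>1 + ?G l\<close> yields one term for
    each subset of \<open>D\<close>.\<close>
  also have "\<dots> = c * (\<Prod>l\<in>D. 1 + ?G l)"
    using prod_add[OF D, of ?G "\<lambda>_. 1"] by (simp add: add.commute)
  finally show ?thesis .
qed

text \<open>Two independent parameter families let one statement cover the cross term and both
  squares. The indicator is idempotent, and \<open>U ^ card X\<close> puts one factor
  \<open>U\<close> on each element, so the integrand is again an indicator times a product over
  \<open>X\<close>.\<close>

lemma multiobject_integral_lmb_density_mult:
  fixes p q :: "'a::euclidean_space \<times> 'l \<Rightarrow> real" and r s :: "'l \<Rightarrow> real" and U :: real
  defines "g \<equiv> \<lambda>(x, l). U * (r l * p (x, l) / (1 - r l)) * (s l * q (x, l) / (1 - s l))"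
  assumes "finite D" "\<And>l. l \<notin> D \<Longrightarrow> r l = 0 \<or> s l = 0"
    and "\<And>l. l \<in> D \<Longrightarrow> integrable lebesgue (\<lambda>x. g (x, l))"
  shows "multiobject_integral (\<lambda>X. U ^ card X * lmb_density r p X * lmb_density s q X) =
    Prod_any (\<lambda>l. 1 - r l) * Prod_any (\<lambda>l. 1 - s l) * (\<Prod>l\<in>D. 1 + attribute_integral g l)"
proof -
  have "U ^ card X * lmb_density r p X * lmb_density s q X =
      distinct_label_indicator X * (Prod_any (\<lambda>l. 1 - r l) * Prod_any (\<lambda>l. 1 - s l)) * prod g X"
    for X
  proof -
    have "prod g X = U ^ card X * (\<Prod>(x, l)\<in>X. r l * p (x, l) / (1 - r l)) *
        (\<Prod>(x, l)\<in>X. s l * q (x, l) / (1 - s l))"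
      unfolding g_def case_prod_unfold prod.distrib prod_constant ..
    then show ?thesis by (simp add: lmb_density_def distinct_label_indicator_def)
  qed
  then show ?thesis
    using multiobject_integral_distinct_label_prod[of D g] assms by auto
qed

section \<open>Signs, measurability and integrability for LMB parameters\<close>

lemma lmb_parameters_bounds:
  assumes "lmb_parameters D r p"
  shows "0 \<le> r l" "r l < 1"
  \<comment> \<open>Outside \<open>D\<close> the default value 0 satisfies both bounds.\<close>
  using assms unfolding lmb_parameters_def by (metis order_refl zero_less_one)+

text \<open>Factors outside \<open>D\<close> equal 1, leaving a finite product of positive numbers.
  Positivity lets the normalising constants cancel in the divergence.\<close>

lemma lmb_parameters_Prod_any_pos:
  assumes "lmb_parameters D r p"
  shows "0 < Prod_any (\<lambda>l. 1 - r l)"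
proof -
  have "Prod_any (\<lambda>l. 1 - r l) = (\<Prod>l\<in>D. 1 - r l)"
    using assms by (intro Prod_any.expand_superset) (auto simp: lmb_parameters_def)
  then show ?thesis using lmb_parameters_bounds[OF assms] by (simp add: prod_pos)
qed

text \<open>Outside \<open>D\<close> the function \<open>p\<close> is arbitrary, but
  \<open>r l = 0\<close> makes the whole expression vanish; hence the case split, here and in the
  next two lemmas.\<close>

lemma lmb_parameters_odds_nonneg:
  assumes "lmb_parameters D r p"
  shows "0 \<le> r l * p (x, l) / (1 - r l)"
proof (cases "l \<in> D")
  case True
  then show ?thesis
    using assms lmb_parameters_bounds[OF assms, of l]
    by (auto simp: lmb_parameters_def probability_density_def)
qed (use assms in \<open>simp add: lmb_parameters_def\<close>)

lemma lmb_parameters_odds_measurable: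
  assumes "lmb_parameters D r p"
  shows "(\<lambda>x. r l * p (x, l) / (1 - r l)) \<in> borel_measurable lebesgue"
proof (cases "l \<in> D")
  case True
  then have "(\<lambda>x. p (x, l)) \<in> borel_measurable lebesgue"
    using assms by (auto simp: lmb_parameters_def probability_density_def)
  then show ?thesis by simp
qed (use assms in \<open>simp add: lmb_parameters_def\<close>)

lemma lmb_parameters_odds_square_integrable:
  assumes "lmb_parameters D r p"
    and "\<And>l. l \<in> D \<Longrightarrow> integrable lebesgue (\<lambda>x. (p (x, l))\<^sup>2)"
  shows "integrable lebesgue (\<lambda>x. (r l * p (x, l) / (1 - r l))\<^sup>2)"
proof (cases "l \<in> D")
  case True
  then show ?thesis using assms(2) by (simp add: power_divide power_mult_distrib)
qed (use assms in \<open>simp add: lmb_parameters_def\<close>)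

text \<open>The sum of the squares dominates the product, so the cross term of two square integrable
  functions has a finite integral.\<close>

lemma integrable_mult_square_integrable:
  fixes u v :: "'a \<Rightarrow> real"
  assumes [measurable]: "u \<in> borel_measurable M" "v \<in> borel_measurable M"
    and "integrable M (\<lambda>x. (u x)\<^sup>2)" "integrable M (\<lambda>x. (v x)\<^sup>2)"
  shows "integrable M (\<lambda>x. u x * v x)"
proof (rule Bochner_Integration.integrable_bound)
  show "integrable M (\<lambda>x. (u x)\<^sup>2 + (v x)\<^sup>2)" using assms by simp
  have "\<bar>a * b\<bar> \<le> a\<^sup>2 + b\<^sup>2" for a b :: real
    using sum_squares_bound[of "\<bar>a\<bar>" "\<bar>b\<bar>"] abs_ge_zero[of "a * b"]
    by (simp only: abs_mult power2_abs)
  then show "AE x in M. norm (u x * v x) \<le> norm ((u x)\<^sup>2 + (v x)\<^sup>2)" by simp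
qed measurable

theorem mainTheorem3:
  fixes U :: real
    and D\<^sub>1 D\<^sub>2 :: "'l::countable set"
    and r\<^sub>1 r\<^sub>2 :: "'l \<Rightarrow> real"
    and p\<^sub>1 p\<^sub>2 f\<^sub>1 f\<^sub>2 :: "'a::euclidean_space \<times> 'l \<Rightarrow> real"
    and \<pi>\<^sub>1 \<pi>\<^sub>2 :: "('a \<times> 'l) set \<Rightarrow> real"
  assumes "U > 0"
    and "lmb_parameters D\<^sub>1 r\<^sub>1 p\<^sub>1"
    and "lmb_parameters D\<^sub>2 r\<^sub>2 p\<^sub>2"
    and "\<And>l. l \<in> D\<^sub>1 \<Longrightarrow> integrable lebesgue (\<lambda>x. (p\<^sub>1 (x, l))\<^sup>2)"
    and "\<And>l. l \<in> D\<^sub>2 \<Longrightarrow> integrable lebesgue (\<lambda>x. (p\<^sub>2 (x, l))\<^sup>2)"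
    and "\<pi>\<^sub>1 = lmb_density r\<^sub>1 p\<^sub>1"
    and "\<pi>\<^sub>2 = lmb_density r\<^sub>2 p\<^sub>2"
    and "\<And>x l. f\<^sub>1 (x, l) = r\<^sub>1 l * p\<^sub>1 (x, l) / (1 - r\<^sub>1 l)"
    and "\<And>x l. f\<^sub>2 (x, l) = r\<^sub>2 l * p\<^sub>2 (x, l) / (1 - r\<^sub>2 l)"
  shows "cauchy_schwarz_divergence U \<pi>\<^sub>1 \<pi>\<^sub>2 =
    - (\<Sum>\<^sub>\<infinity>l. ln ((1 + attribute_integral (\<lambda>z. U * f\<^sub>1 z * f\<^sub>2 z) l) /
        (sqrt (1 + attribute_integral (\<lambda>z. U * (f\<^sub>1 z)\<^sup>2) l) *
         sqrt (1 + attribute_integral (\<lambda>z. U * (f\<^sub>2 z)\<^sup>2) l))))"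
proof -
  \<comment> \<open>A common finite label set for all three integrals: outside it both existence
    probabilities are 0.\<close>
  define D where "D = D\<^sub>1 \<union> D\<^sub>2"
  define c\<^sub>1 c\<^sub>2 where c_def: "c\<^sub>1 = Prod_any (\<lambda>l. 1 - r\<^sub>1 l)" "c\<^sub>2 = Prod_any (\<lambda>l. 1 - r\<^sub>2 l)"
  define a\<^sub>1\<^sub>2 where "a\<^sub>1\<^sub>2 = attribute_integral (\<lambda>z. U * f\<^sub>1 z * f\<^sub>2 z)"
  define a\<^sub>1\<^sub>1 where "a\<^sub>1\<^sub>1 = attribute_integral (\<lambda>z. U * (f\<^sub>1 z)\<^sup>2)"
  define a\<^sub>2\<^sub>2 where "a\<^sub>2\<^sub>2 = attribute_integral (\<lambda>z. U * (f\<^sub>2 z)\<^sup>2)"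
  note f = assms(8,9)
  have D: "finite D" using assms(2,3) by (simp add: D_def lmb_parameters_def)
  have r0: "r\<^sub>1 l = 0" if "l \<notin> D\<^sub>1" for l
    using assms(2) that by (simp add: lmb_parameters_def)
  have s0: "r\<^sub>2 l = 0" if "l \<notin> D\<^sub>2" for l
    using assms(3) that by (simp add: lmb_parameters_def)
  have c: "c\<^sub>1 > 0" "c\<^sub>2 > 0"
    unfolding c_def using assms(2,3) by (blast intro: lmb_parameters_Prod_any_pos)+
  have f0: "f\<^sub>1 (x, l) \<ge> 0" "f\<^sub>2 (x, l) \<ge> 0" for x l
    using lmb_parameters_odds_nonneg assms(2,3) by (simp_all add: f)
  have meas: "(\<lambda>x. f\<^sub>1 (x, l)) \<in> borel_measurable lebesgue"
    "(\<lambda>x. f\<^sub>2 (x, l)) \<in> borel_measurable lebesgue" for l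
    using lmb_parameters_odds_measurable[OF assms(2), of l]
      lmb_parameters_odds_measurable[OF assms(3), of l] by (simp_all add: f)
  have sq: "integrable lebesgue (\<lambda>x. (f\<^sub>1 (x, l))\<^sup>2)" "integrable lebesgue (\<lambda>x. (f\<^sub>2 (x, l))\<^sup>2)" for l
    using lmb_parameters_odds_square_integrable[OF assms(2,4), of l]
      lmb_parameters_odds_square_integrable[OF assms(3,5), of l] by (simp_all add: f)
  have f_eq: "f\<^sub>1 = (\<lambda>(x, l). r\<^sub>1 l * p\<^sub>1 (x, l) / (1 - r\<^sub>1 l))"
    "f\<^sub>2 = (\<lambda>(x, l). r\<^sub>2 l * p\<^sub>2 (x, l) / (1 - r\<^sub>2 l))"
    by (auto simp: f)
  have int: "integrable lebesgue (\<lambda>x. U * f\<^sub>1 (x, l) * f\<^sub>2 (x, l))"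
    "integrable lebesgue (\<lambda>x. U * f\<^sub>1 (x, l) * f\<^sub>1 (x, l))"
    "integrable lebesgue (\<lambda>x. U * f\<^sub>2 (x, l) * f\<^sub>2 (x, l))" for l
    using integrable_mult_square_integrable[OF meas sq] sq
    by (simp_all add: mult.assoc power2_eq_square)
  have I: "multiobject_integral (\<lambda>X. U ^ card X * \<pi>\<^sub>1 X * \<pi>\<^sub>2 X) = c\<^sub>1 * c\<^sub>2 * (\<Prod>l\<in>D. 1 + a\<^sub>1\<^sub>2 l)"
    "multiobject_integral (\<lambda>X. U ^ card X * (\<pi>\<^sub>1 X)\<^sup>2) = c\<^sub>1\<^sup>2 * (\<Prod>l\<in>D. 1 + a\<^sub>1\<^sub>1 l)"
    "multiobject_integral (\<lambda>X. U ^ card X * (\<pi>\<^sub>2 X)\<^sup>2) = c\<^sub>2\<^sup>2 * (\<Prod>l\<in>D. 1 + a\<^sub>2\<^sub>2 l)"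
    using multiobject_integral_lmb_density_mult[OF D, of r\<^sub>1 r\<^sub>2 U p\<^sub>1 p\<^sub>2]
      multiobject_integral_lmb_density_mult[OF D, of r\<^sub>1 r\<^sub>1 U p\<^sub>1 p\<^sub>1]
      multiobject_integral_lmb_density_mult[OF D, of r\<^sub>2 r\<^sub>2 U p\<^sub>2 p\<^sub>2] int r0 s0
    by (simp_all add: assms(6,7) c_def a\<^sub>1\<^sub>2_def a\<^sub>1\<^sub>1_def a\<^sub>2\<^sub>2_def D_def f_eq case_prod_unfold
        power2_eq_square mult.assoc)
  have a: "a\<^sub>1\<^sub>2 l \<ge> 0" "a\<^sub>1\<^sub>1 l \<ge> 0" "a\<^sub>2\<^sub>2 l \<ge> 0" for l
    using \<open>U > 0\<close> f0 by (simp_all add: a\<^sub>1\<^sub>2_def a\<^sub>1\<^sub>1_def a\<^sub>2\<^sub>2_def attribute_integral_def)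
  have a0: "a\<^sub>1\<^sub>2 l = 0" "a\<^sub>1\<^sub>1 l = 0" "a\<^sub>2\<^sub>2 l = 0" if "l \<notin> D" for l
    using that by (simp_all add: a\<^sub>1\<^sub>2_def a\<^sub>1\<^sub>1_def a\<^sub>2\<^sub>2_def attribute_integral_def f r0 s0 D_def)
  let ?q = "\<lambda>l. (1 + a\<^sub>1\<^sub>2 l) / (sqrt (1 + a\<^sub>1\<^sub>1 l) * sqrt (1 + a\<^sub>2\<^sub>2 l))"
  have sqrt_prod: "sqrt (\<Prod>l\<in>D. 1 + b l) = (\<Prod>l\<in>D. sqrt (1 + b l))" for b
    by (induction D rule: infinite_finite_induct) (simp_all add: real_sqrt_mult)
  \<comment> \<open>As \<open>c\<^sub>1\<close> and \<open>c\<^sub>2\<close> are positive, the root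
    of the product of their squares is \<open>c\<^sub>1 * c\<^sub>2\<close> and cancels against the
    numerator.\<close>
  have "cauchy_schwarz_divergence U \<pi>\<^sub>1 \<pi>\<^sub>2 = - ln (\<Prod>l\<in>D. ?q l)"
    using c unfolding cauchy_schwarz_divergence_def I
    by (simp add: real_sqrt_mult sqrt_prod prod_dividef prod.distrib)
  also have "ln (\<Prod>l\<in>D. ?q l) = (\<Sum>l\<in>D. ln (?q l))"
  proof (rule ln_prod[OF D])
    \<comment> \<open>The integrals are nonnegative, so numerator and denominator are both
      positive.\<close>
    fix l show "?q l \<noteq> 0" using a[of l] by simp
  qed
  also have "\<dots> = (\<Sum>\<^sub>\<infinity>l\<in>D. ln (?q l))"
    using D by simp
  also have "\<dots> = (\<Sum>\<^sub>\<infinity>l. ln (?q l))"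
    \<comment> \<open>Outside \<open>D\<close> all three integrals are 0, so the quotient is 1 and
      its logarithm 0.\<close>
    by (rule infsum_cong_neutral) (auto simp: a0)
  finally show ?thesis by (simp only: a\<^sub>1\<^sub>2_def a\<^sub>1\<^sub>1_def a\<^sub>2\<^sub>2_def)
qed

end
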